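(* Let $P$ be an ergodic Markov kernel on a finite set $\mathcal X$, $n=|\mathcal X|\ge3$, reversible with respect to the strictly positive probability distribution $\pi$, and let $k\in\{2,\ldots,n-1\}$. Let $\lambda_1\le\lambda_2\le\cdots\le\lambda_{n-1}$ be the eigenvalues of $P$ on $\ell_0^2(\pi)$, counted with multiplicity, with corresponding $\pi$-orthonormal eigenfunctions $\psi_1,\ldots,\psi_{n-1}$. Put $$L_H=\frac14\operatorname{Tr}(P^2)+\frac{k-2}{4}+\frac12\sum_{j=1}^{k-1}\lambda_j,\qquad g_P=\lambda_k-\lambda_{k-1},\qquad W_P=\lambda_{n-1}-\lambda_1.$$ For every partition $\mathcal O$ of $\mathcal X$ into $k$ nonempty blocks, with $H(\mathcal O)=\bigl\|\tfrac12(P+G_{\mathcal O})-\Pi\bigr\|_{F,\pi}^2$ and $\delta_P(\mathcal O)=\sum_{j=1}^{k-1}\|(I-G_{\mathcal O})\psi_j\|_\pi^2$, $$L_H+\frac{g_P}{2}\,\delta_P(\mathcal O)\le H(\mathcal O)\le L_H+\frac{W_P}{2}\,\delta_P(\mathcal O).$$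
   Context: $\pi(x)>0$ for all $x\in\mathcal X$. $\ell^2(\pi)$ is the space of real functions on $\mathcal X$ with $\langle f,g\rangle_\pi=\sum_x\pi(x)f(x)g(x)$ and norm $\|\cdot\|_\pi$; $\ell^2_0(\pi)=\{f:\sum_x\pi(x)f(x)=0\}$. Kernels act by $(Pf)(x)=\sum_yP(x,y)f(y)$. Ergodic means irreducible and aperiodic; reversible means $\pi(x)P(x,y)=\pi(y)P(y,x)$ for all $x,y$. $\Pi(x,y)=\pi(y)$. The Gibbs kernel of $\mathcal O=\{O_1,\ldots,O_k\}$ is $G_{\mathcal O}(x,y)=\sum_{i=1}^k\mathbf 1_{O_i}(x)\mathbf 1_{O_i}(y)\pi(y)/\pi(O_i)$. For an operator $A$ on $\ell^2(\pi)$, $\|A\|_{F,\pi}^2=\operatorname{Tr}(A^*A)=\sum_{x,y}\frac{\pi(x)}{\pi(y)}A(x,y)^2$. $\operatorname{Tr}(P^2)$ is the trace on all of $\ell^2(\pi)$. One choice of eigenbasis $\psi_1,\ldots,\psi_{n-1}$ of $\ell^2_0(\pi)$ ($P\psi_j=\lambda_j\psi_j$) is fixed throughout. *)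

theory Defs
  imports "HOL-Analysis.Analysis"
begin

text \<open>
  The finite state space is a type \<open>'a::finite\<close>, so \<open>n\<close> is \<open>CARD('a)\<close>. Functions on it are vectors
  \<open>real ^ 'a\<close> and kernels are matrices \<open>real ^ 'a ^ 'a\<close> with entries \<open>P $ x $ y\<close>; the action of a
  kernel on a function is \<open>P *v f\<close>, composition of kernels is \<open>P ** Q\<close>, and the trace of an operator
  on the full space of functions is the library's \<open>trace\<close>.
\<close>

definition pos_distribution :: "real ^ 'a::finite \<Rightarrow> bool" where
  "pos_distribution p \<longleftrightarrow> (\<forall>x. p $ x > 0) \<and> (\<Sum>x\<in>UNIV. p $ x) = 1"

definition markov_kernel :: "real ^ 'a ^ 'a::finite \<Rightarrow> bool" where
  "markov_kernel P \<longleftrightarrow> (\<forall>x y. P $ x $ y \<ge> 0) \<and> (\<forall>x. (\<Sum>y\<in>UNIV. P $ x $ y) = 1)"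

text \<open>Iterated matrix product; \<open>P ^ m\<close> on the vector type would be an entrywise power.\<close>

definition kernel_power :: "real ^ 'a ^ 'a::finite \<Rightarrow> nat \<Rightarrow> real ^ 'a ^ 'a" where
  "kernel_power P m = (((**) P) ^^ m) (mat 1)"

definition irreducible_kernel :: "real ^ 'a ^ 'a::finite \<Rightarrow> bool" where
  "irreducible_kernel P \<longleftrightarrow> (\<forall>x y. \<exists>m\<ge>1. kernel_power P m $ x $ y > 0)"

definition aperiodic_kernel :: "real ^ 'a ^ 'a::finite \<Rightarrow> bool" where
  "aperiodic_kernel P \<longleftrightarrow> (\<forall>x. Gcd {m. m \<ge> 1 \<and> kernel_power P m $ x $ x > 0} = 1)"

definition ergodic_kernel :: "real ^ 'a ^ 'a::finite \<Rightarrow> bool" where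
  "ergodic_kernel P \<longleftrightarrow> irreducible_kernel P \<and> aperiodic_kernel P"

definition reversible_wrt :: "real ^ 'a \<Rightarrow> real ^ 'a ^ 'a::finite \<Rightarrow> bool" where
  "reversible_wrt p P \<longleftrightarrow> (\<forall>x y. p $ x * P $ x $ y = p $ y * P $ y $ x)"

definition pi_inner :: "real ^ 'a::finite \<Rightarrow> real ^ 'a \<Rightarrow> real ^ 'a \<Rightarrow> real" where
  "pi_inner p f g = (\<Sum>x\<in>UNIV. p $ x * f $ x * g $ x)"

definition pi_norm :: "real ^ 'a::finite \<Rightarrow> real ^ 'a \<Rightarrow> real" where
  "pi_norm p f = sqrt (pi_inner p f f)"

definition l2_zero :: "real ^ 'a::finite \<Rightarrow> (real ^ 'a) set" where
  "l2_zero p = {f. (\<Sum>x\<in>UNIV. p $ x * f $ x) = 0}"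

definition stationary_kernel :: "real ^ 'a::finite \<Rightarrow> real ^ 'a ^ 'a" where
  "stationary_kernel p = (\<chi> x y. p $ y)"

definition gibbs_kernel :: "real ^ 'a::finite \<Rightarrow> 'a set set \<Rightarrow> real ^ 'a ^ 'a" where
  "gibbs_kernel p Os =
     (\<chi> x y. \<Sum>B\<in>Os. indicator B x * indicator B y * p $ y / (\<Sum>z\<in>B. p $ z))"

definition pi_adjoint :: "real ^ 'a::finite \<Rightarrow> real ^ 'a ^ 'a \<Rightarrow> real ^ 'a ^ 'a" where
  "pi_adjoint p A = (\<chi> x y. p $ y * A $ y $ x / p $ x)"

definition frobenius_norm :: "real ^ 'a::finite \<Rightarrow> real ^ 'a ^ 'a \<Rightarrow> real" where
  "frobenius_norm p A = sqrt (trace (pi_adjoint p A ** A))"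

lemma pi_adjoint_adjoint:
  assumes "pos_distribution p"
  shows "pi_inner p (pi_adjoint p A *v f) g = pi_inner p f (A *v g)"
proof -
  have "p $ x \<noteq> 0" for x
    using assms by (metis pos_distribution_def less_irrefl)
  then have "pi_inner p (pi_adjoint p A *v f) g
      = (\<Sum>x\<in>UNIV. \<Sum>y\<in>UNIV. p $ y * f $ y * A $ y $ x * g $ x)"
    by (simp add: pi_inner_def pi_adjoint_def matrix_vector_mult_def
        sum_distrib_left sum_distrib_right mult_ac)
  also have "\<dots> = (\<Sum>y\<in>UNIV. \<Sum>x\<in>UNIV. p $ y * f $ y * A $ y $ x * g $ x)"
    by (rule sum.swap)
  also have "\<dots> = pi_inner p f (A *v g)"
    by (simp add: pi_inner_def matrix_vector_mult_def sum_distrib_left mult_ac)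
  finally show ?thesis .
qed

lemma frobenius_norm_squared:
  assumes "pos_distribution p"
  shows "(frobenius_norm p A)\<^sup>2 = (\<Sum>x\<in>UNIV. \<Sum>y\<in>UNIV. p $ x / p $ y * (A $ x $ y)\<^sup>2)"
proof -
  have "trace (pi_adjoint p A ** A) = (\<Sum>y\<in>UNIV. \<Sum>x\<in>UNIV. p $ x / p $ y * (A $ x $ y)\<^sup>2)"
    by (simp add: trace_def pi_adjoint_def matrix_matrix_mult_def power2_eq_square mult_ac)
  also have "\<dots> = (\<Sum>x\<in>UNIV. \<Sum>y\<in>UNIV. p $ x / p $ y * (A $ x $ y)\<^sup>2)"
    by (rule sum.swap)
  finally have eq: "trace (pi_adjoint p A ** A) = \<dots>" .
  have "0 < p $ x" for x
    using assms by (simp add: pos_distribution_def)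
  then have "0 \<le> (\<Sum>x\<in>UNIV. \<Sum>y\<in>UNIV. p $ x / p $ y * (A $ x $ y)\<^sup>2)"
    by (intro sum_nonneg mult_nonneg_nonneg divide_nonneg_nonneg) (auto intro: less_imp_le)
  then show ?thesis
    by (simp add: frobenius_norm_def eq)
qed

text \<open>
  The indices of the eigenvalues run through \<open>1, \<dots>, n - 1\<close> with \<open>n = CARD('a)\<close>; the values of \<open>lam\<close>
  and \<open>psi\<close> elsewhere are irrelevant. Since the \<open>psi j\<close> form an orthonormal eigenbasis of
  \<open>l2_zero p\<close>, the \<open>lam j\<close> are exactly the eigenvalues on that space, with multiplicity.
\<close>

definition ordered_eigenbasis ::
    "real ^ 'a::finite \<Rightarrow> real ^ 'a ^ 'a \<Rightarrow> (nat \<Rightarrow> real) \<Rightarrow> (nat \<Rightarrow> real ^ 'a) \<Rightarrow> bool" where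
  "ordered_eigenbasis p P lam psi \<longleftrightarrow>
     span (psi ` {1..CARD('a) - 1}) = l2_zero p \<and>
     (\<forall>i\<in>{1..CARD('a) - 1}. \<forall>j\<in>{1..CARD('a) - 1}.
        pi_inner p (psi i) (psi j) = (if i = j then 1 else 0)) \<and>
     (\<forall>j\<in>{1..CARD('a) - 1}. P *v psi j = lam j *\<^sub>R psi j) \<and>
     mono_on {1..CARD('a) - 1} lam"

definition L_H :: "real ^ 'a ^ 'a::finite \<Rightarrow> (nat \<Rightarrow> real) \<Rightarrow> nat \<Rightarrow> real" where
  "L_H P lam k = trace (P ** P) / 4 + (real k - 2) / 4 + (\<Sum>j=1..k - 1. lam j) / 2"

definition H_objective :: "real ^ 'a::finite \<Rightarrow> real ^ 'a ^ 'a \<Rightarrow> 'a set set \<Rightarrow> real" where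
  "H_objective p P Os =
     (frobenius_norm p ((1 / 2) *\<^sub>R (P + gibbs_kernel p Os) - stationary_kernel p))\<^sup>2"

definition delta :: "real ^ 'a::finite \<Rightarrow> (nat \<Rightarrow> real ^ 'a) \<Rightarrow> nat \<Rightarrow> 'a set set \<Rightarrow> real" where
  "delta p psi k Os = (\<Sum>j=1..k - 1. (pi_norm p ((mat 1 - gibbs_kernel p Os) *v psi j))\<^sup>2)"

end

theory Submission
  imports Defs
begin

text \<open>
  Write \<open>G\<close> for the Gibbs kernel and \<open>a j = \<langle>psi j, G psi j\<rangle>\<close>. Since \<open>G\<close> is a self-adjoint projection
  of trace \<open>k\<close> fixing the constants, \<open>0 \<le> a j \<le> 1\<close> and the \<open>a j\<close> sum to \<open>k - 1\<close>. Computing traces in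
  the basis consisting of the constant function and the \<open>psi j\<close> turns the objective into
  \<open>Tr (P\<^sup>2) / 4 + (k - 2) / 4 + (\<Sum>j. lam j * a j) / 2\<close>. Its excess over \<open>L_H\<close> is half of
  \<open>(\<Sum>j\<ge>k. lam j * a j) - (\<Sum>j<k. lam j * (1 - a j))\<close>, and both families of weights
  \<open>a j\<close> (\<open>j \<ge> k\<close>) and \<open>1 - a j\<close> (\<open>j < k\<close>) have total mass \<open>delta\<close>.
\<close>

section \<open>The weighted inner product and reversible kernels\<close>

lemma pi_inner_commute: "pi_inner p f g = pi_inner p g f"
  by (simp add: pi_inner_def mult_ac)

lemma pi_inner_add_left: "pi_inner p (f + g) h = pi_inner p f h + pi_inner p g h"
  by (simp add: pi_inner_def algebra_simps sum.distrib)

lemma pi_inner_add_right: "pi_inner p h (f + g) = pi_inner p h f + pi_inner p h g"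
  by (simp add: pi_inner_def algebra_simps sum.distrib)

lemma pi_inner_diff_left: "pi_inner p (f - g) h = pi_inner p f h - pi_inner p g h"
  by (simp add: pi_inner_def algebra_simps sum_subtractf)

lemma pi_inner_diff_right: "pi_inner p h (f - g) = pi_inner p h f - pi_inner p h g"
  by (simp add: pi_inner_def algebra_simps sum_subtractf)

lemma pi_inner_scaleR_left: "pi_inner p (c *\<^sub>R f) h = c * pi_inner p f h"
  by (simp add: pi_inner_def sum_distrib_left mult_ac)

lemma pi_inner_scaleR_right: "pi_inner p h (c *\<^sub>R f) = c * pi_inner p h f"
  by (simp add: pi_inner_def sum_distrib_left mult_ac)

lemmas pi_inner_linear = pi_inner_add_left pi_inner_add_right pi_inner_diff_left
  pi_inner_diff_right pi_inner_scaleR_left pi_inner_scaleR_right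

lemma pi_inner_self_nonneg:
  assumes "pos_distribution p"
  shows "0 \<le> pi_inner p f f"
  using assms unfolding pi_inner_def pos_distribution_def
  by (intro sum_nonneg) (simp add: mult.assoc less_imp_le)

lemma pi_norm_squared:
  assumes "pos_distribution p"
  shows "(pi_norm p f)\<^sup>2 = pi_inner p f f"
  using pi_inner_self_nonneg[OF assms] by (simp add: pi_norm_def)

lemma pi_inner_axis: "pi_inner p f (axis x 1) = p $ x * f $ x"
  by (simp add: pi_inner_def axis_def if_distrib cong: if_cong)

lemma pi_inner_reversible:
  assumes "reversible_wrt p A"
  shows "pi_inner p f (A *v g) = pi_inner p (A *v f) g"
proof -
  have "pi_inner p f (A *v g) = (\<Sum>x\<in>UNIV. \<Sum>y\<in>UNIV. (p $ x * A $ x $ y) * (f $ x * g $ y))"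
    by (simp add: pi_inner_def matrix_vector_mult_def sum_distrib_left mult_ac)
  also have "\<dots> = (\<Sum>x\<in>UNIV. \<Sum>y\<in>UNIV. (p $ y * A $ y $ x) * (f $ x * g $ y))"
    using assms by (simp add: reversible_wrt_def)
  also have "\<dots> = (\<Sum>y\<in>UNIV. \<Sum>x\<in>UNIV. (p $ y * A $ y $ x) * (f $ x * g $ y))"
    by (rule sum.swap)
  also have "\<dots> = pi_inner p (A *v f) g"
    by (simp add: pi_inner_def matrix_vector_mult_def sum_distrib_left sum_distrib_right mult_ac)
  finally show ?thesis .
qed

text \<open>Detailed balance says that \<open>A\<close> is its own adjoint. Entrywise, it lets one
  factor \<open>A $ x $ y\<close> absorb the weight \<open>p $ x / p $ y\<close> and become
  \<open>A $ y $ x\<close>.\<close>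

lemma frobenius_norm_reversible:
  assumes "pos_distribution p" and "reversible_wrt p A"
  shows "(frobenius_norm p A)\<^sup>2 = trace (A ** A)"
proof -
  have nz: "p $ x \<noteq> 0" for x
    using assms(1) by (metis pos_distribution_def less_irrefl)
  have "p $ x / p $ y * (A $ x $ y)\<^sup>2 = A $ x $ y * A $ y $ x" for x y
  proof -
    have "p $ x * A $ x $ y = p $ y * A $ y $ x"
      using assms(2) by (simp add: reversible_wrt_def)
    then have "A $ y $ x = p $ x * A $ x $ y / p $ y"
      using nz[of y] by (simp add: field_simps)
    then show ?thesis
      by (simp add: power2_eq_square)
  qed
  then show ?thesis
    unfolding frobenius_norm_squared[OF assms(1)]
    by (simp add: trace_def matrix_matrix_mult_def)
qed

section \<open>Orthonormal expansions and the trace\<close>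

text \<open>Both sides are linear in \<open>f\<close>, so it suffices to check the generators
  \<open>psi i\<close>, where orthonormality leaves a single term.\<close>

lemma orthonormal_expansion:
  assumes "finite J"
    and orth: "\<And>i j. i \<in> J \<Longrightarrow> j \<in> J \<Longrightarrow> pi_inner p (psi i) (psi j) = (if i = j then 1 else 0)"
    and "f \<in> span (psi ` J)"
  shows "f = (\<Sum>j\<in>J. pi_inner p (psi j) f *\<^sub>R psi j)"
  using \<open>f \<in> span (psi ` J)\<close>
proof (induction rule: span_induct_alt)
  case base
  then show ?case
    by (simp add: pi_inner_def)
next
  case (step c g h)
  then obtain i where i: "i \<in> J" "g = psi i"
    by blast
  have "(\<Sum>j\<in>J. pi_inner p (psi j) g *\<^sub>R psi j) = (\<Sum>j\<in>J. if j = i then psi j else 0)"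
    using i orth by (intro sum.cong) auto
  also have "\<dots> = g"
    using i \<open>finite J\<close> by simp
  finally have "(\<Sum>j\<in>J. pi_inner p (psi j) g *\<^sub>R psi j) = g" .
  then have "(\<Sum>j\<in>J. pi_inner p (psi j) (c *\<^sub>R g + h) *\<^sub>R psi j)
      = c *\<^sub>R g + (\<Sum>j\<in>J. pi_inner p (psi j) h *\<^sub>R psi j)"
    by (simp add: pi_inner_linear scaleR_add_left sum.distrib flip: scaleR_scaleR scaleR_sum_right)
  then show ?case
    using step.IH by simp
qed

text \<open>The constant function has norm 1 and is orthogonal to \<open>l2_zero p\<close>, so it
  completes the \<open>psi j\<close> to an orthonormal basis of the whole space. The trace can be
  read off in any such basis.\<close>

lemma trace_orthonormal_basis:
  assumes p: "pos_distribution p" and "finite J"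
    and orth: "\<And>i j. i \<in> J \<Longrightarrow> j \<in> J \<Longrightarrow> pi_inner p (psi i) (psi j) = (if i = j then 1 else 0)"
    and span: "span (psi ` J) = l2_zero p"
  shows "trace M = pi_inner p 1 (M *v 1) + (\<Sum>j\<in>J. pi_inner p (psi j) (M *v psi j))"
proof -
  \<comment> \<open>Completeness relation: the identity matrix is the sum of the rank-one
    projections onto the basis, with \<open>p $ x\<close> coming from the constant function.\<close>
  have res: "p $ x + (\<Sum>j\<in>J. p $ x * psi j $ x * psi j $ y) = (if x = y then 1 else 0)" for x y
  proof -
    \<comment> \<open>A point mass minus its projection onto the constants, whose coefficient is the
      mean \<open>p $ x\<close> of the point mass.\<close>
    let ?f = "axis x 1 - p $ x *\<^sub>R 1 :: real ^ 'a"
    have "pi_inner p 1 ?f = 0"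
      using p unfolding pi_inner_linear pi_inner_axis
      by (simp add: pi_inner_def pos_distribution_def)
    then have "?f \<in> span (psi ` J)"
      unfolding span by (simp add: l2_zero_def pi_inner_def)
    from orthonormal_expansion[OF \<open>finite J\<close> orth this]
    have "?f = (\<Sum>j\<in>J. pi_inner p (psi j) ?f *\<^sub>R psi j)"
      by simp
    also have "\<dots> = (\<Sum>j\<in>J. (p $ x * psi j $ x) *\<^sub>R psi j)"
    proof (intro sum.cong refl)
      fix j assume "j \<in> J"
      then have "psi j \<in> l2_zero p"
        by (metis imageI span span_base)
      then have "pi_inner p (psi j) 1 = 0"
        by (simp add: l2_zero_def pi_inner_def)
      then show "pi_inner p (psi j) ?f *\<^sub>R psi j = (p $ x * psi j $ x) *\<^sub>R psi j"
        unfolding pi_inner_linear pi_inner_axis by simp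
    qed
    finally have "?f $ y = (\<Sum>j\<in>J. (p $ x * psi j $ x) *\<^sub>R psi j) $ y"
      by simp
    then show ?thesis
      by (auto simp: axis_def)
  qed
  have "pi_inner p 1 (M *v 1) + (\<Sum>j\<in>J. pi_inner p (psi j) (M *v psi j))
     = (\<Sum>x\<in>UNIV. \<Sum>y\<in>UNIV. M $ x $ y * p $ x)
       + (\<Sum>j\<in>J. \<Sum>x\<in>UNIV. \<Sum>y\<in>UNIV. M $ x $ y * (p $ x * psi j $ x * psi j $ y))"
    by (simp add: pi_inner_def matrix_vector_mult_def sum_distrib_left mult_ac)
  also have "(\<Sum>j\<in>J. \<Sum>x\<in>UNIV. \<Sum>y\<in>UNIV. M $ x $ y * (p $ x * psi j $ x * psi j $ y))
     = (\<Sum>x\<in>UNIV. \<Sum>y\<in>UNIV. \<Sum>j\<in>J. M $ x $ y * (p $ x * psi j $ x * psi j $ y))"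
    by (subst sum.swap, rule sum.cong[OF refl], rule sum.swap)
  also have "(\<Sum>x\<in>UNIV. \<Sum>y\<in>UNIV. M $ x $ y * p $ x) + \<dots>
     = (\<Sum>x\<in>UNIV. \<Sum>y\<in>UNIV. M $ x $ y * (p $ x + (\<Sum>j\<in>J. p $ x * psi j $ x * psi j $ y)))"
    by (simp add: distrib_left sum.distrib sum_distrib_left)
  also have "\<dots> = trace M"
    unfolding res by (simp add: trace_def if_distrib cong: if_cong)
  finally show ?thesis ..
qed

section \<open>The Gibbs kernel as an orthogonal projection\<close>

lemma gibbs_kernel_block:
  fixes p :: "real ^ 'a::finite"
  assumes "partition_on UNIV Os" and "B \<in> Os" and "x \<in> B"
  shows "gibbs_kernel p Os $ x $ y = indicator B y * p $ y / (\<Sum>z\<in>B. p $ z)"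
proof -
  have "indicator C x = (if C = B then 1 else 0 :: real)" if "C \<in> Os" for C
    using that assms by (auto simp: partition_on_def disjoint_def indicator_def)
  then have "gibbs_kernel p Os $ x $ y
      = (\<Sum>C\<in>Os. if C = B then indicator C y * p $ y / (\<Sum>z\<in>C. p $ z) else 0)"
    using assms(3) by (auto simp: gibbs_kernel_def simp del: sum.delta intro!: sum.cong)
  also have "\<dots> = indicator B y * p $ y / (\<Sum>z\<in>B. p $ z)"
    using assms(2) by simp
  finally show ?thesis .
qed

text \<open>The kernel acts as conditional expectation given the block; the properties that follow
  rest on this averaging form.\<close>

lemma gibbs_kernel_apply:
  fixes p :: "real ^ 'a::finite"
  assumes "partition_on UNIV Os" and "B \<in> Os" and "x \<in> B"
  shows "(gibbs_kernel p Os *v f) $ x = (\<Sum>y\<in>B. p $ y * f $ y) / (\<Sum>z\<in>B. p $ z)"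
proof -
  have "(gibbs_kernel p Os *v f) $ x
      = (\<Sum>y\<in>UNIV. indicator B y * (p $ y * f $ y)) / (\<Sum>z\<in>B. p $ z)"
    by (simp add: matrix_vector_mult_def gibbs_kernel_block[OF assms] sum_divide_distrib mult_ac)
  then show ?thesis
    by (simp add: indicator_def if_distrib sum.If_cases cong: if_cong)
qed

lemma partition_block_exists:
  assumes "partition_on UNIV Os"
  obtains B where "B \<in> Os" "x \<in> B"
  using assms by (metis UNIV_I UnionE partition_on_def)

lemma block_mass_pos:
  fixes p :: "real ^ 'a::finite"
  assumes "pos_distribution p" and "B \<noteq> {}"
  shows "0 < (\<Sum>z\<in>B. p $ z)"
  using assms by (intro sum_pos) (auto simp: pos_distribution_def)

lemma gibbs_kernel_one:
  assumes "pos_distribution p" and "partition_on UNIV Os"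
  shows "gibbs_kernel p Os *v 1 = 1"
proof (rule vec_eq_iff[THEN iffD2], rule allI)
  fix x
  obtain B where "B \<in> Os" "x \<in> B"
    using partition_block_exists[OF assms(2)] .
  then show "(gibbs_kernel p Os *v 1) $ x = 1 $ x"
    using block_mass_pos[OF assms(1), of B] gibbs_kernel_apply[OF assms(2)] by fastforce
qed

text \<open>After one averaging the function is constant on each block, and averaging a constant
  changes nothing.\<close>

lemma gibbs_kernel_idempotent:
  assumes "pos_distribution p" and "partition_on UNIV Os"
  shows "gibbs_kernel p Os *v (gibbs_kernel p Os *v f) = gibbs_kernel p Os *v f"
proof (rule vec_eq_iff[THEN iffD2], rule allI)
  fix x
  obtain B where B: "B \<in> Os" "x \<in> B"
    using partition_block_exists[OF assms(2)] .
  let ?c = "(\<Sum>y\<in>B. p $ y * f $ y) / (\<Sum>z\<in>B. p $ z)"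
  have "(gibbs_kernel p Os *v (gibbs_kernel p Os *v f)) $ x
      = (\<Sum>y\<in>B. p $ y * ?c) / (\<Sum>z\<in>B. p $ z)"
    using B gibbs_kernel_apply[OF assms(2)] by simp
  also have "\<dots> = ?c"
    using B block_mass_pos[OF assms(1), of B] unfolding sum_distrib_right[symmetric] by auto
  finally show "(gibbs_kernel p Os *v (gibbs_kernel p Os *v f)) $ x = (gibbs_kernel p Os *v f) $ x"
    using B gibbs_kernel_apply[OF assms(2)] by simp
qed

lemma gibbs_kernel_reversible: "reversible_wrt p (gibbs_kernel p Os)"
  by (simp add: reversible_wrt_def gibbs_kernel_def sum_distrib_left mult_ac)

text \<open>The diagonal entries over one block form a probability distribution, so every block
  contributes exactly 1.\<close>

lemma trace_gibbs_kernel: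
  fixes p :: "real ^ 'a::finite"
  assumes "pos_distribution p" and "partition_on UNIV Os"
  shows "trace (gibbs_kernel p Os) = card Os"
proof -
  have "trace (gibbs_kernel p Os)
      = (\<Sum>B\<in>Os. \<Sum>x\<in>UNIV. indicator B x * indicator B x * p $ x / (\<Sum>z\<in>B. p $ z))"
    unfolding trace_def gibbs_kernel_def by (simp, rule sum.swap)
  also have "\<dots> = (\<Sum>B\<in>Os. 1)"
  proof (intro sum.cong refl)
    fix B assume "B \<in> Os"
    then have "(\<Sum>z\<in>B. p $ z) \<noteq> 0"
      using block_mass_pos[OF assms(1), of B] assms(2) by (fastforce simp: partition_on_def)
    moreover have "(\<Sum>x\<in>UNIV. indicator B x * indicator B x * p $ x / (\<Sum>z\<in>B. p $ z))
        = (\<Sum>x\<in>B. p $ x / (\<Sum>z\<in>B. p $ z))"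
      by (intro sum.mono_neutral_cong_right) auto
    ultimately show "(\<Sum>x\<in>UNIV. indicator B x * indicator B x * p $ x / (\<Sum>z\<in>B. p $ z)) = 1"
      by (simp flip: sum_divide_distrib)
  qed
  finally show ?thesis
    by simp
qed

section \<open>Transport of weight across the spectral gap\<close>

text \<open>The weights \<open>a\<close> are a relaxed choice of \<open>k - 1\<close> indices.
  Compared with choosing the first \<open>k - 1\<close>, they move mass \<open>d\<close> from low to
  high indices, and each unit moved costs at least \<open>lam k - lam (k - 1)\<close> and at most
  \<open>lam m - lam 1\<close>.\<close>

lemma weighted_eigenvalue_bounds:
  fixes a lam :: "nat \<Rightarrow> real"
  assumes "2 \<le> k" and "k \<le> m" and mono: "mono_on {1..m} lam"
    and a: "\<And>j. j \<in> {1..m} \<Longrightarrow> 0 \<le> a j \<and> a j \<le> 1"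
    and mass: "(\<Sum>j=1..m. a j) = real k - 1"
  defines "d \<equiv> \<Sum>j=1..k - 1. 1 - a j"
  shows "(\<Sum>j=1..k - 1. lam j) + (lam k - lam (k - 1)) * d \<le> (\<Sum>j=1..m. lam j * a j)"
    and "(\<Sum>j=1..m. lam j * a j) \<le> (\<Sum>j=1..k - 1. lam j) + (lam m - lam 1) * d"
proof -
  have "{1..m} = {1..k - 1} \<union> {k..m}"
    using assms(1,2) by auto
  then have split: "(\<Sum>j=1..m. f j) = (\<Sum>j=1..k - 1. f j) + (\<Sum>j=k..m. f j)" for f :: "nat \<Rightarrow> real"
    using assms(1) by (simp add: sum.union_disjoint)
  \<comment> \<open>As the total mass is \<open>k - 1\<close>, what is missing below
    \<open>k\<close> reappears from \<open>k\<close> on.\<close>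
  have d: "d = (\<Sum>j=k..m. a j)"
    using mass split[of a] assms(1) by (simp add: d_def sum_subtractf of_nat_diff)
  have excess: "(\<Sum>j=1..m. lam j * a j) - (\<Sum>j=1..k - 1. lam j)
      = (\<Sum>j=k..m. lam j * a j) - (\<Sum>j=1..k - 1. lam j * (1 - a j))"
    unfolding split by (simp add: right_diff_distrib sum_subtractf)
  have le: "lam i \<le> lam j" if "1 \<le> i" "i \<le> j" "j \<le> m" for i j
    using that by (intro mono_onD[OF mono]) auto
  have "lam k * d \<le> (\<Sum>j=k..m. lam j * a j)" "(\<Sum>j=k..m. lam j * a j) \<le> lam m * d"
    unfolding d sum_distrib_left using assms(1) a
    by (auto intro!: sum_mono mult_right_mono le)
  moreover have "(\<Sum>j=1..k - 1. lam j * (1 - a j)) \<le> lam (k - 1) * d"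
    "lam 1 * d \<le> (\<Sum>j=1..k - 1. lam j * (1 - a j))"
    unfolding d_def sum_distrib_left using assms(1,2) a
    by (auto intro!: sum_mono mult_right_mono le)
  ultimately show "(\<Sum>j=1..k - 1. lam j) + (lam k - lam (k - 1)) * d \<le> (\<Sum>j=1..m. lam j * a j)"
    and "(\<Sum>j=1..m. lam j * a j) \<le> (\<Sum>j=1..k - 1. lam j) + (lam m - lam 1) * d"
    using excess by (simp_all add: left_diff_distrib)
qed

section \<open>Evaluating the objective in the eigenbasis\<close>

theorem theorem5p2:
  fixes p :: "real ^ 'a::finite"
    and P :: "real ^ 'a ^ 'a"
    and lam :: "nat \<Rightarrow> real"
    and psi :: "nat \<Rightarrow> real ^ 'a"
    and n k :: nat
    and Os :: "'a set set"
  assumes "n = CARD('a)" and "n \<ge> 3"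
    and "pos_distribution p"
    and "markov_kernel P" and "ergodic_kernel P" and "reversible_wrt p P"
    and "k \<in> {2..n - 1}"
    and "ordered_eigenbasis p P lam psi"
    and "partition_on UNIV Os" and "card Os = k"
  shows "L_H P lam k + (lam k - lam (k - 1)) / 2 * delta p psi k Os \<le> H_objective p P Os
    \<and> H_objective p P Os \<le> L_H P lam k + (lam (n - 1) - lam 1) / 2 * delta p psi k Os"
proof -
  note p = \<open>pos_distribution p\<close> and part = \<open>partition_on UNIV Os\<close>
  define G where "G = gibbs_kernel p Os"
  define A where "A = (1 / 2) *\<^sub>R (P + G) - stationary_kernel p"
  define J where "J = {1..n - 1}"
  define a where "a j = pi_inner p (psi j) (G *v psi j)" for j
  have span: "span (psi ` J) = l2_zero p"
    and orth: "\<And>i j. i \<in> J \<Longrightarrow> j \<in> J \<Longrightarrow> pi_inner p (psi i) (psi j) = (if i = j then 1 else 0)"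
    and eig: "\<And>j. j \<in> J \<Longrightarrow> P *v psi j = lam j *\<^sub>R psi j"
    and mono: "mono_on J lam"
    using assms(1,8) by (auto simp: ordered_eigenbasis_def J_def)
  have tr: "trace M = pi_inner p 1 (M *v 1) + (\<Sum>j\<in>J. pi_inner p (psi j) (M *v psi j))" for M
    using trace_orthonormal_basis[OF p _ orth span] by (simp add: J_def)
  have one: "pi_inner p 1 1 = 1"
    using p by (simp add: pi_inner_def pos_distribution_def)
  have P1: "P *v 1 = 1"
    using assms(4) by (simp add: markov_kernel_def matrix_vector_mult_def vec_eq_iff)
  have G1: "G *v 1 = 1"
    unfolding G_def by (rule gibbs_kernel_one[OF p part])
  have GG: "pi_inner p (G *v f) (G *v f) = pi_inner p f (G *v f)" for f
    unfolding G_def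
    by (metis pi_inner_reversible[OF gibbs_kernel_reversible] gibbs_kernel_idempotent[OF p part])
  \<comment> \<open>The stationary kernel sends \<open>f\<close> to the constant function equal to
    its mean.\<close>
  have A_apply: "A *v f = (1 / 2) *\<^sub>R (P *v f + G *v f) - pi_inner p 1 f *\<^sub>R 1" for f
    by (simp add: A_def matrix_vector_mult_def vec_eq_iff stationary_kernel_def pi_inner_def
        algebra_simps sum.distrib sum_subtractf sum_distrib_left sum_divide_distrib)
  have "reversible_wrt p G"
    unfolding G_def by (rule gibbs_kernel_reversible)
  then have "reversible_wrt p A"
    using assms(6) by (simp add: A_def reversible_wrt_def stationary_kernel_def algebra_simps)
  have a0: "0 \<le> a j" for j
    unfolding a_def by (metis GG pi_inner_self_nonneg[OF p])
  \<comment> \<open>Pythagoras for the projection \<open>G\<close> and the unit vector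
    \<open>psi j\<close>. This gives both \<open>a j \<le> 1\<close> and the form of
    \<open>delta\<close>.\<close>
  have compl: "(pi_norm p ((mat 1 - G) *v psi j))\<^sup>2 = 1 - a j" if "j \<in> J" for j
    using that orth[of j j] GG[of "psi j"]
    by (simp add: pi_norm_squared[OF p] matrix_vector_mult_diff_rdistrib pi_inner_linear a_def
        pi_inner_commute[of p "G *v psi j" "psi j"])
  have a1: "a j \<le> 1" if "j \<in> J" for j
    using compl[OF that] by (smt (verit) zero_le_power2)
  \<comment> \<open>The constant function accounts for 1 of the trace \<open>k\<close>, which leaves
    \<open>k - 1\<close> for the \<open>a j\<close>.\<close>
  have trG: "real k = 1 + (\<Sum>j\<in>J. a j)"
    using tr[of G] trace_gibbs_kernel[OF p part] assms(10) by (simp add: G_def[symmetric] G1 one a_def)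
  have trP: "trace (P ** P) = 1 + (\<Sum>j\<in>J. (lam j)\<^sup>2)"
    unfolding tr using orth
    by (simp add: P1 one eig pi_inner_linear matrix_vector_mult_scaleR power2_eq_square
        flip: matrix_vector_mul_assoc)
  \<comment> \<open>Self-adjointness turns the diagonal entry into the squared norm of
    \<open>A *v psi j\<close>. The mean term vanishes on \<open>psi j\<close>, and the square of the
    half-sum of \<open>P\<close> and \<open>G\<close> yields the three terms.\<close>
  have "pi_inner p (psi j) ((A ** A) *v psi j) = (lam j)\<^sup>2 / 4 + lam j * a j / 2 + a j / 4"
    if "j \<in> J" for j
  proof -
    have "psi j \<in> l2_zero p"
      using that by (metis imageI span span_base)
    then have "pi_inner p 1 (psi j) = 0"
      by (simp add: l2_zero_def pi_inner_def)
    then have Apsi: "A *v psi j = (1 / 2) *\<^sub>R (lam j *\<^sub>R psi j + G *v psi j)"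
      by (simp add: A_apply eig[OF that])
    have "pi_inner p (psi j) ((A ** A) *v psi j) = pi_inner p (A *v psi j) (A *v psi j)"
      by (simp add: pi_inner_reversible[OF \<open>reversible_wrt p A\<close>] flip: matrix_vector_mul_assoc)
    also have "\<dots> = (lam j)\<^sup>2 / 4 + lam j * a j / 2 + a j / 4"
      unfolding Apsi pi_inner_linear GG pi_inner_commute[of p "G *v psi j" "psi j"]
      using orth[OF that that] by (simp add: a_def[symmetric] power2_eq_square field_simps)
    finally show ?thesis .
  qed
  \<comment> \<open>Subtracting the stationary kernel removes the constant direction, so only the
    \<open>psi j\<close> enter the trace.\<close>
  moreover have "A *v 1 = 0"
    by (simp add: A_apply P1 G1 one vec_eq_iff)
  ultimately have "trace (A ** A) = (\<Sum>j\<in>J. (lam j)\<^sup>2 / 4 + lam j * a j / 2 + a j / 4)"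
    unfolding tr by (simp add: pi_inner_def flip: matrix_vector_mul_assoc)
  also have "\<dots> = (\<Sum>j\<in>J. (lam j)\<^sup>2) / 4 + (\<Sum>j\<in>J. lam j * a j) / 2 + (\<Sum>j\<in>J. a j) / 4"
    by (simp add: sum.distrib sum_divide_distrib)
  \<comment> \<open>The \<open>a j\<close> sum to \<open>k - 1\<close>, and
    \<open>trace (P ** P)\<close> counts one extra 1 for the constant function; together they give
    \<open>k - 2\<close>.\<close>
  also have "\<dots> = trace (P ** P) / 4 + (real k - 2) / 4 + (\<Sum>j\<in>J. lam j * a j) / 2"
    using trG trP by (simp add: field_simps)
  finally have H: "H_objective p P Os = trace (P ** P) / 4 + (real k - 2) / 4 + (\<Sum>j\<in>J. lam j * a j) / 2"
    using frobenius_norm_reversible[OF p \<open>reversible_wrt p A\<close>]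
    by (simp only: H_objective_def A_def G_def)
  have D: "delta p psi k Os = (\<Sum>j=1..k - 1. 1 - a j)"
    unfolding delta_def G_def[symmetric] using compl assms(7)
    by (intro sum.cong) (auto simp: J_def)
  \<comment> \<open>These bounds keep both \<open>k - 1\<close> and \<open>k\<close> inside
    \<open>J\<close>, where \<open>lam\<close> is known to be monotone.\<close>
  have "2 \<le> k" "k \<le> n - 1"
    using assms(7) by auto
  note bounds = weighted_eigenvalue_bounds[OF this mono[unfolded J_def], of a]
  show ?thesis
    unfolding H D L_H_def
    using bounds[folded J_def] a0 a1 trG by (simp add: J_def field_simps)
qed

end
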